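(* Let $R$ be a commutative ring with identity, let $M$ be an $R$-module, and let $S$ and $T$ be sets. If there exist an $R$-module isomorphism $f : R_0^S \to M$ and an $R$-module isomorphism $g : R_0^T \to M$, then $|S| = |T|$.
   Context: For a commutative ring $R$ with identity and a set $S$, $R_0^S$ denotes the $R$-module of all functions $S \to R$ with finite support. For $S=\emptyset$, $R_0^S=\{\mathbf 0\}$. $|S|$ denotes the cardinality of $S$ (sets may be infinite).
   Formalization: The ring R is additionally assumed to be nonzero (1 ≠ 0); over the zero ring the claim fails, since every R_0^S is then the one-element module (take S empty and T a singleton). *)

theory Defs
  imports
    "HOL-Library.Equipollence"
    "Jordan_Normal_Form.Missing_VectorSpace"
begin

text \<open>
  The free module $R_0^S$: the submodule of the function module on \<open>S\<close> formed by the functions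
  of finite support. As in the function module, a function \<open>S \<rightarrow> R\<close> is represented by its unique
  extensional representative, so that for empty \<open>S\<close> there is exactly one such function.
\<close>

definition finsupp_module ::
    "('a, 'c) ring_scheme \<Rightarrow> 's set \<Rightarrow> ('a, 's \<Rightarrow> 'a) module" where
  "finsupp_module R S = (ring.func_space R S)
     \<lparr>carrier := {f \<in> S \<rightarrow>\<^sub>E carrier R. finite {s \<in> S. f s \<noteq> \<zero>\<^bsub>R\<^esub>}}\<rparr>"

definition module_iso ::
    "('a, 'c) ring_scheme \<Rightarrow> ('a, 'm, 'd) module_scheme \<Rightarrow> ('a, 'n, 'e) module_scheme
      \<Rightarrow> ('m \<Rightarrow> 'n) set" where
  "module_iso R M N = {f \<in> module_hom R M N. bij_betw f (carrier M) (carrier N)}"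

lemma finsupp_module_is_module:
  assumes "cring R"
  shows "module R (finsupp_module R S)"
proof -
  interpret cring R by fact
  let ?F = "func_space S :: ('a, 'c \<Rightarrow> 'a) module"
  let ?H = "{f \<in> S \<rightarrow>\<^sub>E carrier R. finite {s \<in> S. f s \<noteq> \<zero>\<^bsub>R\<^esub>}}"
  interpret F: Module.module R ?F by (rule func_space_is_module)
  have sub: "?H \<subseteq> carrier ?F"
    by (auto simp: func_space_def)
  have zero: "\<zero>\<^bsub>?F\<^esub> \<in> ?H"
    by (auto simp: func_space_def)
  have add: "x \<oplus>\<^bsub>?F\<^esub> y \<in> ?H" if "x \<in> ?H" "y \<in> ?H" for x y
  proof -
    have "{s \<in> S. (x \<oplus>\<^bsub>?F\<^esub> y) s \<noteq> \<zero>\<^bsub>R\<^esub>} \<subseteq> {s \<in> S. x s \<noteq> \<zero>\<^bsub>R\<^esub>} \<union> {s \<in> S. y s \<noteq> \<zero>\<^bsub>R\<^esub>}"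
      using that by (auto simp: func_space_def)
    moreover have "x \<oplus>\<^bsub>?F\<^esub> y \<in> S \<rightarrow>\<^sub>E carrier R"
      using that by (auto simp: func_space_def PiE_iff)
    moreover have "finite ({s \<in> S. x s \<noteq> \<zero>\<^bsub>R\<^esub>} \<union> {s \<in> S. y s \<noteq> \<zero>\<^bsub>R\<^esub>})"
      using that by blast
    ultimately show ?thesis using finite_subset by blast
  qed
  have smult: "a \<odot>\<^bsub>?F\<^esub> x \<in> ?H" if "a \<in> carrier R" "x \<in> ?H" for a x
  proof -
    have "{s \<in> S. (a \<odot>\<^bsub>?F\<^esub> x) s \<noteq> \<zero>\<^bsub>R\<^esub>} \<subseteq> {s \<in> S. x s \<noteq> \<zero>\<^bsub>R\<^esub>}"
      using that by (auto simp: func_space_def)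
    moreover have "a \<odot>\<^bsub>?F\<^esub> x \<in> S \<rightarrow>\<^sub>E carrier R"
      using that by (auto simp: func_space_def PiE_iff)
    moreover have "finite {s \<in> S. x s \<noteq> \<zero>\<^bsub>R\<^esub>}"
      using that by blast
    ultimately show ?thesis using finite_subset by blast
  qed
  have neg: "\<ominus>\<^bsub>?F\<^esub> x \<in> ?H" if "x \<in> ?H" for x
  proof -
    have x: "x \<in> carrier ?F" using that sub by blast
    have "\<ominus>\<^bsub>?F\<^esub> x = (\<ominus>\<^bsub>R\<^esub> \<one>\<^bsub>R\<^esub>) \<odot>\<^bsub>?F\<^esub> x"
      using F.smult_l_minus[OF one_closed x] F.smult_one[OF x] by simp
    then show ?thesis using smult[OF _ that, of "\<ominus>\<^bsub>R\<^esub> \<one>\<^bsub>R\<^esub>"] by simp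
  qed
  have "Module.submodule ?H R ?F"
    by (rule F.submoduleI[OF sub zero neg add smult])
  then show ?thesis
    unfolding finsupp_module_def
    by (rule Module.submodule.submodule_is_module[OF _ F.module_axioms])
qed

end

theory Submission
  imports "HOL-Algebra.QuotRing" "HOL-Algebra.Ring_Divisibility" Defs
begin

text \<open>
  Let \<open>h\<close> be a surjective module homomorphism from $R_0^S$ to $R_0^T$; its matrix has columns of
  finite support and a right inverse, so every row is nonzero and \<open>T\<close> is the union of the supports
  of the columns. If \<open>S\<close> is infinite, this union of \<open>|S|\<close> finite sets has at most \<open>|S|\<close> elements.
  If \<open>S\<close> is finite, so is \<open>T\<close>, and the matrix identity survives in the quotient by a maximal ideal;
  there, \<open>|T| > |S|\<close> would give the right inverse a nonzero kernel vector by elimination, which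
  does not need division, only a domain. Antisymmetry of the cardinal order then finishes the proof.
\<close>

section \<open>Matrices with a right inverse\<close>

lemma (in cring) exists_maximalideal:
  assumes "\<one> \<noteq> \<zero>"
  shows "\<exists>I. maximalideal I R"
proof -
  \<comment> \<open>Properness is encoded by the absence of \<open>\<one>\<close>, a condition that
    passes to the union of a nonempty chain, as Zorn's lemma requires.\<close>
  let ?A = "{I. ideal I R \<and> \<one> \<notin> I}"
  have "{\<zero>} \<in> ?A"
    using assms zeroideal by auto
  then have "\<exists>M\<in>?A. \<forall>X\<in>?A. M \<subseteq> X \<longrightarrow> X = M"
  proof (intro subset_Zorn_nonempty)
    fix C assume "C \<noteq> {}" and C: "subset.chain ?A C"
    then have "subset.chain {I. ideal I R} C"
      by (auto simp: subset_chain_def)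
    from chain_Union_is_ideal[OF this] \<open>C \<noteq> {}\<close> C show "\<Union>C \<in> ?A"
      by (auto simp: subset_chain_def)
  qed auto
  then obtain M where M: "ideal M R" "\<one> \<notin> M"
    and max: "\<And>X. ideal X R \<Longrightarrow> \<one> \<notin> X \<Longrightarrow> M \<subseteq> X \<Longrightarrow> X = M"
    by blast
  have "maximalideal M R"
  proof (rule maximalidealI)
    show "carrier R \<noteq> M" using M(2) one_closed by blast
  qed (use M max ideal.one_imp_carrier in blast)+
  then show ?thesis ..
qed

text \<open>Induction on the equations: one equation with a nonzero coefficient eliminates one
  unknown. Multiplying by the pivot replaces dividing by it, and the absence of zero divisors keeps
  the solution nonzero.\<close>

lemma (in domain) exists_nontrivial_solution:
  fixes v :: "'s \<Rightarrow> 't \<Rightarrow> 'a"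
  assumes "finite S" "finite T" "card S < card T"
    and "\<And>s t. s \<in> S \<Longrightarrow> t \<in> T \<Longrightarrow> v s t \<in> carrier R"
  shows "\<exists>c \<in> T \<rightarrow> carrier R. (\<exists>t\<in>T. c t \<noteq> \<zero>) \<and> (\<forall>s\<in>S. (\<Oplus>t\<in>T. v s t \<otimes> c t) = \<zero>)"
  using assms
proof (induction S arbitrary: T v rule: finite_induct)
  case empty
  then have "\<exists>t. t \<in> T" by (metis card_gt_0_iff card.empty ex_in_conv)
  then show ?case by (intro bexI[of _ "\<lambda>_. \<one>"]) auto
next
  case (insert s S)
  show ?case
  proof (cases "\<forall>t\<in>T. v s t = \<zero>")
    case True
    obtain c where c: "c \<in> T \<rightarrow> carrier R" "\<exists>t\<in>T. c t \<noteq> \<zero>"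
      "\<forall>s\<in>S. (\<Oplus>t\<in>T. v s t \<otimes> c t) = \<zero>"
      using insert.IH[of T v] insert.prems insert.hyps by auto
    have "(\<Oplus>t\<in>T. v s t \<otimes> c t) = \<zero>"
      using True c(1) by (intro add.finprod_one_eqI) (auto simp: Pi_iff)
    with c show ?thesis by blast
  next
    case False
    then obtain t0 where t0: "t0 \<in> T" "v s t0 \<noteq> \<zero>" by blast
    define p where "p = v s t0"
    define T' where "T' = T - {t0}"
    have T: "T = insert t0 T'" "t0 \<notin> T'" "finite T'"
      using t0 insert.prems by (auto simp: T'_def)
    have v: "v r t \<in> carrier R" if "r \<in> insert s S" "t \<in> T" for r t
      using that insert.prems by blast
    have p: "p \<in> carrier R" "p \<noteq> \<zero>" using t0 v by (auto simp: p_def)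
    \<comment> \<open>Cross-multiplied elimination: \<open>p\<close> times row \<open>r\<close>
      minus \<open>v r t0\<close> times the pivot row \<open>s\<close>, which cancels the
      coefficient of \<open>t0\<close>.\<close>
    define w where "w r t = p \<otimes> v r t \<ominus> v r t0 \<otimes> v s t" for r t
    have w: "w r t \<in> carrier R" if "r \<in> insert s S" "t \<in> T" for r t
      using that v t0 p by (auto simp: w_def)
    have "card S < card T'"
      using insert.prems insert.hyps t0 T by auto
    then obtain c where c: "c \<in> T' \<rightarrow> carrier R" "\<exists>t\<in>T'. c t \<noteq> \<zero>"
      "\<forall>r\<in>S. (\<Oplus>t\<in>T'. w r t \<otimes> c t) = \<zero>"
      using insert.IH[of T' w] T w by auto
    \<comment> \<open>The pivot row eliminates itself, so \<open>c0\<close> holds for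
      \<open>r = s\<close> as well and the pivot equation is checked together with all the
      others.\<close>
    have ws: "w r t = \<zero>" if "r = s" "t \<in> T" for r t
      using that v[of s t] p by (simp add: w_def p_def[symmetric])
    have c0: "(\<Oplus>t\<in>T'. w r t \<otimes> c t) = \<zero>" if "r \<in> insert s S" for r
    proof (cases "r = s")
      case True
      then show ?thesis
        using c(1) T ws by (intro add.finprod_one_eqI) (auto simp: Pi_iff)
    qed (use that c in auto)
    define a where "a = (\<Oplus>t\<in>T'. v s t \<otimes> c t)"
    have vc: "(\<lambda>t. v s t \<otimes> c t) \<in> T' \<rightarrow> carrier R"
      using v c T by auto
    have a: "a \<in> carrier R" unfolding a_def by (rule finsum_closed[OF vc])
    \<comment> \<open>Back substitution: with \<open>c\<close> scaled by \<open>p\<close>, the pivot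
      equation forces the value at \<open>t0\<close> to be minus \<open>a\<close>.\<close>
    define d where "d t = (if t = t0 then \<ominus> a else p \<otimes> c t)" for t
    have d: "d \<in> T \<rightarrow> carrier R" using a p c(1) T by (auto simp: d_def Pi_iff)
    have "(\<Oplus>t\<in>T. v r t \<otimes> d t) = \<zero>" if r: "r \<in> insert s S" for r
    proof -
      have vt0: "v r t0 \<in> carrier R" using v r t0 by blast
      have wc: "(\<lambda>t. w r t \<otimes> c t) \<in> T' \<rightarrow> carrier R"
        using w r c T by auto
      have "(\<Oplus>t\<in>T'. v r t \<otimes> d t) = (\<Oplus>t\<in>T'. w r t \<otimes> c t \<oplus> v r t0 \<otimes> (v s t \<otimes> c t))"
      proof (rule finsum_cong'[OF refl])
        fix t assume t: "t \<in> T'"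
        then have "c t \<in> carrier R" "v r t \<in> carrier R" "v s t \<in> carrier R"
          using c v r T by auto
        moreover have "t \<noteq> t0" using t T by auto
        ultimately show "v r t \<otimes> d t = w r t \<otimes> c t \<oplus> v r t0 \<otimes> (v s t \<otimes> c t)"
          using p vt0 unfolding w_def d_def by (simp) algebra
      qed (use wc vc vt0 in auto)
      also have "\<dots> = (\<Oplus>t\<in>T'. w r t \<otimes> c t) \<oplus> (\<Oplus>t\<in>T'. v r t0 \<otimes> (v s t \<otimes> c t))"
        using wc vc vt0 by (intro finsum_addf) auto
      also have "\<dots> = v r t0 \<otimes> a"
        unfolding c0[OF r] finsum_rdistr[OF T(3) vt0 vc, symmetric] a_def[symmetric]
        using vt0 a by simp
      finally have eq: "(\<Oplus>t\<in>T'. v r t \<otimes> d t) = v r t0 \<otimes> a" .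
      have "(\<Oplus>t\<in>T. v r t \<otimes> d t) = v r t0 \<otimes> d t0 \<oplus> (\<Oplus>t\<in>T'. v r t \<otimes> d t)"
        unfolding T(1) using T d v r vt0 by (intro finsum_insert) (auto simp: Pi_iff)
      also have "\<dots> = \<zero>"
        unfolding eq using vt0 a by (simp add: d_def r_minus l_neg)
      finally show ?thesis .
    qed
    moreover have "\<exists>t\<in>T. d t \<noteq> \<zero>"
    proof -
      obtain t where "t \<in> T'" "c t \<noteq> \<zero>" using c by blast
      then show ?thesis
        using c p T integral_iff by (intro bexI[of _ t]) (auto simp: d_def)
    qed
    ultimately show ?thesis using d by blast
  qed
qed

text \<open>If \<open>T\<close> were larger, \<open>B\<close> would have more columns than rows and
  hence a nonzero kernel vector \<open>c\<close>; but
  \<open>c = (A B) c = A (B c) = \<zero>\<close>.\<close>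

lemma (in domain) right_invertible_matrix_card_le:
  fixes A :: "'t \<Rightarrow> 's \<Rightarrow> 'a"
  assumes fin: "finite S" "finite T"
    and A: "\<And>s t. s \<in> S \<Longrightarrow> t \<in> T \<Longrightarrow> A t s \<in> carrier R"
    and B: "\<And>s t. s \<in> S \<Longrightarrow> t \<in> T \<Longrightarrow> B s t \<in> carrier R"
    and AB: "\<And>t u. t \<in> T \<Longrightarrow> u \<in> T \<Longrightarrow> (\<Oplus>s\<in>S. A t s \<otimes> B s u) = (if t = u then \<one> else \<zero>)"
  shows "card T \<le> card S"
proof (rule ccontr)
  assume "\<not> card T \<le> card S"
  then obtain c where c: "c \<in> T \<rightarrow> carrier R" "\<exists>t\<in>T. c t \<noteq> \<zero>"
    "\<forall>s\<in>S. (\<Oplus>t\<in>T. B s t \<otimes> c t) = \<zero>"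
    using exists_nontrivial_solution[of S T B] fin B by auto
  have "c t = \<zero>" if t: "t \<in> T" for t
  proof -
    have "\<zero> = (\<Oplus>s\<in>S. A t s \<otimes> (\<Oplus>u\<in>T. B s u \<otimes> c u))"
      using c A t by (intro add.finprod_one_eqI[symmetric]) auto
    also have "\<dots> = (\<Oplus>s\<in>S. \<Oplus>u\<in>T. A t s \<otimes> (B s u \<otimes> c u))"
      using A B c t fin
      by (intro finsum_cong'[OF refl] finsum_rdistr) (auto simp: Pi_iff intro!: finsum_closed)
    also have "\<dots> = (\<Oplus>u\<in>T. \<Oplus>s\<in>S. A t s \<otimes> (B s u \<otimes> c u))"
      using A B c t fin by (intro finsum_finsum_swap) (auto simp: Pi_iff)
    also have "\<dots> = (\<Oplus>u\<in>T. if t = u then c u else \<zero>)"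
    proof (rule finsum_cong'[OF refl])
      fix u assume u: "u \<in> T"
      have "(\<Oplus>s\<in>S. A t s \<otimes> (B s u \<otimes> c u)) = (\<Oplus>s\<in>S. A t s \<otimes> B s u \<otimes> c u)"
        using A B c t u by (intro finsum_cong'[OF refl]) (auto simp: Pi_iff m_assoc)
      also have "\<dots> = (\<Oplus>s\<in>S. A t s \<otimes> B s u) \<otimes> c u"
        using A B c t u fin by (intro finsum_ldistr[symmetric]) auto
      finally show "(\<Oplus>s\<in>S. A t s \<otimes> (B s u \<otimes> c u)) = (if t = u then c u else \<zero>)"
        using AB[OF t u] funcset_mem[OF c(1) u] by simp
    qed (use c in auto)
    also have "\<dots> = c t"
      by (rule finsum_singleton[OF t fin(2) c(1)])
    finally show ?thesis by simp
  qed
  with c show False by blast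
qed

text \<open>The identity \<open>A B = 1\<close> is preserved by the projection onto the quotient by
  a maximal ideal. Maximal ideals are prime, so this quotient is a domain and the previous bound
  applies there.\<close>

lemma (in cring) right_invertible_matrix_card_le:
  fixes A :: "'t \<Rightarrow> 's \<Rightarrow> 'a"
  assumes nontrivial: "\<one> \<noteq> \<zero>" and fin: "finite S" "finite T"
    and A: "\<And>s t. s \<in> S \<Longrightarrow> t \<in> T \<Longrightarrow> A t s \<in> carrier R"
    and B: "\<And>s t. s \<in> S \<Longrightarrow> t \<in> T \<Longrightarrow> B s t \<in> carrier R"
    and AB: "\<And>t u. t \<in> T \<Longrightarrow> u \<in> T \<Longrightarrow> (\<Oplus>s\<in>S. A t s \<otimes> B s u) = (if t = u then \<one> else \<zero>)"
  shows "card T \<le> card S"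
proof -
  obtain I where "maximalideal I R"
    using exists_maximalideal[OF nontrivial] by blast
  then interpret I: primeideal I R
    by (rule maximalideal_prime)
  interpret Q: "domain" "R Quot I" by (rule I.quotient_is_domain)
  interpret h: ring_hom_cring R "R Quot I" "(+>) I" by (rule I.rcos_ring_hom_cring)
  show ?thesis
  proof (rule Q.right_invertible_matrix_card_le[OF fin])
    fix t u assume tu: "t \<in> T" "u \<in> T"
    \<comment> \<open>The summand is rewritten as a composition with the projection, the form in
      which a homomorphism passes through a finite sum.\<close>
    have "(\<Oplus>\<^bsub>R Quot I\<^esub>s\<in>S. (I +> A t s) \<otimes>\<^bsub>R Quot I\<^esub> (I +> B s u))
        = (\<Oplus>\<^bsub>R Quot I\<^esub>s\<in>S. ((+>) I \<circ> (\<lambda>s. A t s \<otimes> B s u)) s)"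
      using A B tu by (intro Q.finsum_cong'[OF refl]) (auto simp: Pi_iff)
    also have "\<dots> = I +> (\<Oplus>s\<in>S. A t s \<otimes> B s u)"
      using A B tu by (subst h.hom_finsum) (auto simp: o_def)
    finally show "(\<Oplus>\<^bsub>R Quot I\<^esub>s\<in>S. (I +> A t s) \<otimes>\<^bsub>R Quot I\<^esub> (I +> B s u))
        = (if t = u then \<one>\<^bsub>R Quot I\<^esub> else \<zero>\<^bsub>R Quot I\<^esub>)"
      using AB[OF tu] by auto
  qed (use A B in auto)
qed

section \<open>Cardinality of a union of finite sets\<close>

lemma Union_finite_lepoll:
  includes cardinal_syntax
  assumes "infinite A" "\<And>x. x \<in> A \<Longrightarrow> finite (F x)"
  shows "(\<Union>x\<in>A. F x) \<lesssim> A"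
proof -
  \<comment> \<open>A finite set embeds into the infinite set \<open>A\<close>, and a union of at
    most \<open>|A|\<close> sets of size at most \<open>|A|\<close> has size at most
    \<open>|A|\<close>.\<close>
  have "|F x| \<le>o |A|" if "x \<in> A" for x
    using finite_lepoll_infinite[OF assms(1)] assms(2)[OF that]
    by (simp add: lepoll_def card_of_ordLeq)
  then have "|\<Union>x\<in>A. F x| \<le>o |A|"
    using card_of_UNION_ordLeq_infinite[OF assms(1) card_of_mono1[OF order_refl]] by blast
  then show ?thesis
    by (simp add: lepoll_def card_of_ordLeq)
qed

section \<open>Homomorphisms of free modules as matrices\<close>

definition finsupp_unit :: "('a, 'c) ring_scheme \<Rightarrow> 's set \<Rightarrow> 's \<Rightarrow> 's \<Rightarrow> 'a" where
  "finsupp_unit R S s = (\<lambda>x\<in>S. if x = s then \<one>\<^bsub>R\<^esub> else \<zero>\<^bsub>R\<^esub>)"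

context cring
begin

lemma finsupp_module_simps:
  "carrier (finsupp_module R S) = {f \<in> S \<rightarrow>\<^sub>E carrier R. finite {s \<in> S. f s \<noteq> \<zero>}}"
  "f \<oplus>\<^bsub>finsupp_module R S\<^esub> g = (\<lambda>s\<in>S. f s \<oplus> g s)"
  "a \<odot>\<^bsub>finsupp_module R S\<^esub> f = (\<lambda>s\<in>S. a \<otimes> f s)"
  by (simp_all add: finsupp_module_def func_space_def)

text \<open>An index outside \<open>S\<close> gives the zero function, so \<open>s\<close> may range
  over its whole type.\<close>

lemma finsupp_unit_carrier: "finsupp_unit R S s \<in> carrier (finsupp_module R S)"
proof -
  have "{x \<in> S. finsupp_unit R S s x \<noteq> \<zero>} \<subseteq> {s}"
    by (auto simp: finsupp_unit_def)
  then show ?thesis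
    by (auto simp: finsupp_module_simps finsupp_unit_def intro: finite_subset)
qed

text \<open>Linearity gives the matrix-vector product whose columns are the images of the unit
  vectors. Letting \<open>U\<close> be any finite set that contains the support makes induction on
  \<open>U\<close> possible and lets later uses take the support itself or a finite
  \<open>S\<close>.\<close>

lemma finsupp_module_hom_apply:
  assumes h: "h \<in> module_hom R (finsupp_module R S) (finsupp_module R T)"
    and t: "t \<in> T" and U: "finite U" "U \<subseteq> S"
    and f: "f \<in> carrier (finsupp_module R S)" "\<And>s. s \<in> S - U \<Longrightarrow> f s = \<zero>"
  shows "h f t = (\<Oplus>s\<in>U. h (finsupp_unit R S s) t \<otimes> f s)"
  using U f
proof (induction U arbitrary: f rule: finite_induct)
  case empty
  have hf: "h f \<in> T \<rightarrow>\<^sub>E carrier R"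
    using module_hom_closed[OF h] empty.prems by (auto simp: finsupp_module_simps)
  \<comment> \<open>Here \<open>f\<close> vanishes on all of \<open>S\<close>, so it equals its
    multiple by zero; compatibility with scalars then makes \<open>h f\<close> vanish too.\<close>
  have "\<zero> \<odot>\<^bsub>finsupp_module R S\<^esub> f = f"
    using empty.prems by (auto simp: finsupp_module_simps fun_eq_iff PiE_iff extensional_def)
  then have "\<zero> \<odot>\<^bsub>finsupp_module R T\<^esub> h f = h f"
    using module_hom_smult[OF h zero_closed empty.prems(2)] by metis
  then have "(\<zero> \<odot>\<^bsub>finsupp_module R T\<^esub> h f) t = h f t"
    by (rule fun_cong)
  then show ?case
    using t PiE_mem[OF hf t] by (simp add: finsupp_module_simps)
next
  case (insert s U)
  let ?e = "finsupp_unit R S s"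
  \<comment> \<open>Clearing the coordinate \<open>s\<close> leaves a function supported in
    \<open>U\<close>, and \<open>f\<close> is \<open>g\<close> plus \<open>f s\<close> times the
    unit vector at \<open>s\<close>.\<close>
  define g where "g = f(s := \<zero>)"
  have s: "s \<in> S" using insert.prems by auto
  have fS: "f \<in> S \<rightarrow>\<^sub>E carrier R" "finite {s \<in> S. f s \<noteq> \<zero>}"
    using insert.prems by (auto simp: finsupp_module_simps)
  have "{x \<in> S. g x \<noteq> \<zero>} \<subseteq> {x \<in> S. f x \<noteq> \<zero>}"
    by (auto simp: g_def)
  then have "finite {x \<in> S. g x \<noteq> \<zero>}"
    using fS(2) by (rule finite_subset)
  moreover have "g \<in> S \<rightarrow>\<^sub>E carrier R"
    using fS s by (auto simp: g_def PiE_iff extensional_def)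
  ultimately have g: "g \<in> carrier (finsupp_module R S)"
    by (simp add: finsupp_module_simps)
  have e: "?e \<in> carrier (finsupp_module R S)" by (rule finsupp_unit_carrier)
  have fs: "f s \<in> carrier R" using fS s by auto
  interpret F: module R "finsupp_module R S"
    by (rule finsupp_module_is_module) (rule cring_axioms)
  have car: "h (finsupp_unit R S x) t \<in> carrier R" for x
    using funcset_mem[OF module_hom_closed[OF h] finsupp_unit_carrier] t
    by (auto simp: finsupp_module_simps)
  have fU: "f x \<in> carrier R" if "x \<in> insert s U" for x
    using fS(1) that insert.prems(1) by blast
  have "g \<oplus>\<^bsub>finsupp_module R S\<^esub> (f s \<odot>\<^bsub>finsupp_module R S\<^esub> ?e) = f"
    using fS s by (auto simp: finsupp_module_simps g_def finsupp_unit_def fun_eq_iff PiE_iff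
        extensional_def)
  then have "h f = h g \<oplus>\<^bsub>finsupp_module R T\<^esub> (f s \<odot>\<^bsub>finsupp_module R T\<^esub> h ?e)"
    using module_hom_add[OF h g F.smult_closed[OF fs e]] module_hom_smult[OF h fs e] by metis
  then have "h f t = h g t \<oplus> f s \<otimes> h ?e t"
    using t by (simp add: finsupp_module_simps)
  also have "h g t = (\<Oplus>x\<in>U. h (finsupp_unit R S x) t \<otimes> g x)"
    using insert.prems(1,3) by (intro insert.IH g) (auto simp: g_def)
  also have "\<dots> = (\<Oplus>x\<in>U. h (finsupp_unit R S x) t \<otimes> f x)"
    using insert.hyps car fU by (intro finsum_cong'[OF refl]) (auto simp: g_def)
  also have "\<dots> \<oplus> f s \<otimes> h ?e t = h ?e t \<otimes> f s \<oplus> (\<Oplus>x\<in>U. h (finsupp_unit R S x) t \<otimes> f x)"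
    using car fU fs by (simp add: a_comm m_comm finsum_closed Pi_iff)
  also have "\<dots> = (\<Oplus>x\<in>insert s U. h (finsupp_unit R S x) t \<otimes> f x)"
    using insert.hyps car fU by (intro finsum_insert[symmetric]) auto
  finally show ?case .
qed

text \<open>Surjectivity provides preimages of the unit vectors, which are the columns of a right
  inverse of the matrix \<open>A\<close> of \<open>h\<close>. For finite \<open>S\<close> the matrix
  bound decides; for infinite \<open>S\<close> it is enough that each column of \<open>A\<close> has
  finite support and that these supports cover \<open>T\<close>.\<close>

lemma finsupp_module_surj_lepoll:
  assumes nontrivial: "\<one> \<noteq> \<zero>"
    and h: "h \<in> module_hom R (finsupp_module R S) (finsupp_module R T)"
    and surj: "carrier (finsupp_module R T) \<subseteq> h ` carrier (finsupp_module R S)"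
  shows "T \<lesssim> S"
proof -
  define A where "A t s = h (finsupp_unit R S s) t" for t s
  define supp where "supp s = {t \<in> T. A t s \<noteq> \<zero>}" for s
  have "\<exists>b \<in> carrier (finsupp_module R S). h b = finsupp_unit R T t" for t
    using surj finsupp_unit_carrier[of T t] by (metis imageE subsetD)
  then obtain b where b: "b t \<in> carrier (finsupp_module R S)" "h (b t) = finsupp_unit R T t" for t
    by metis
  have hS: "h (finsupp_unit R S s) \<in> carrier (finsupp_module R T)" for s
    by (rule funcset_mem[OF module_hom_closed[OF h] finsupp_unit_carrier])
  have A: "A t s \<in> carrier R" if "t \<in> T" for t s
    using hS that by (auto simp: A_def finsupp_module_simps)
  have fin_supp: "finite (supp s)" for s
    using hS by (auto simp: supp_def A_def finsupp_module_simps)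
  have B: "b t s \<in> carrier R" if "s \<in> S" for s t
    using b(1)[of t] that by (auto simp: finsupp_module_simps)
  \<comment> \<open>The set \<open>U\<close> stays free: the covering argument takes the support of
    one preimage, the finite case takes all of \<open>S\<close>.\<close>
  have AB: "(\<Oplus>s\<in>U. A t s \<otimes> b u s) = (if t = u then \<one> else \<zero>)"
    if "t \<in> T" "finite U" "U \<subseteq> S" "\<And>s. s \<in> S - U \<Longrightarrow> b u s = \<zero>" for t u U
    using finsupp_module_hom_apply[OF h that(1-3) b(1)[of u] that(4)] that(1) b(2)
    by (simp add: A_def finsupp_unit_def)
  have T: "T \<subseteq> (\<Union>s\<in>S. supp s)"
  proof
    fix t assume t: "t \<in> T"
    let ?U = "{s \<in> S. b t s \<noteq> \<zero>}"
    have "finite ?U"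
      using b(1)[of t] by (simp add: finsupp_module_simps)
    then have "(\<Oplus>s\<in>?U. A t s \<otimes> b t s) = (if t = t then \<one> else \<zero>)"
      by (intro AB[OF t]) auto
    \<comment> \<open>The diagonal entry is \<open>\<one>\<close>, so some summand is nonzero, and
      its factor \<open>A t s\<close> puts \<open>t\<close> into the support of column
      \<open>s\<close>.\<close>
    then have "(\<Oplus>s\<in>?U. A t s \<otimes> b t s) \<noteq> \<zero>"
      using nontrivial by simp
    then obtain s where s: "s \<in> S" "A t s \<otimes> b t s \<noteq> \<zero>"
      using add.finprod_one_eqI[of ?U "\<lambda>s. A t s \<otimes> b t s"] by blast
    then have "A t s \<noteq> \<zero>"
      using B by auto
    with s(1) t show "t \<in> (\<Union>s\<in>S. supp s)"
      by (auto simp: supp_def)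
  qed
  show ?thesis
  proof (cases "finite S")
    case True
    then have "finite T"
      using T fin_supp finite_subset by blast
    then have "card T \<le> card S"
      using True A B AB[OF _ True]
      by (intro right_invertible_matrix_card_le[OF nontrivial True, of T A "\<lambda>s t. b t s"]) auto
    then show ?thesis
      using True \<open>finite T\<close> by (simp add: lepoll_iff_card_le)
  next
    case False
    then have "(\<Union>s\<in>S. supp s) \<lesssim> S"
      using fin_supp by (rule Union_finite_lepoll)
    with T show ?thesis
      using lepoll_trans subset_imp_lepoll by blast
  qed
qed

end

section \<open>From isomorphisms to cardinalities\<close>

lemma module_iso_inv_comp:
  assumes "module R M" "module R N"
    and f: "f \<in> module_iso R M P" and g: "g \<in> module_iso R N P"
  shows "inv_into (carrier N) g \<circ> f \<in> module_iso R M N"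
proof -
  interpret M: module R M by fact
  interpret N: module R N by fact
  let ?k = "inv_into (carrier N) g"
  have bij: "bij_betw f (carrier M) (carrier P)" "bij_betw g (carrier N) (carrier P)"
    and hom: "f \<in> module_hom R M P" "g \<in> module_hom R N P"
    using f g by (auto simp: module_iso_def)
  have comp: "bij_betw (?k \<circ> f) (carrier M) (carrier N)"
    using bij bij_betw_inv_into bij_betw_trans by blast
  then have car: "(?k \<circ> f) x \<in> carrier N" if "x \<in> carrier M" for x
    using that bij_betwE by blast
  have gk: "g ((?k \<circ> f) x) = f x" if "x \<in> carrier M" for x
    using that bij bij_betwE[OF bij(1)] by (simp add: bij_betw_inv_into_right)
  \<comment> \<open>Injectivity of \<open>g\<close> determines a value of the composite by its image
    under \<open>g\<close>, so both homomorphism laws reduce to those of \<open>f\<close> and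
    \<open>g\<close>.\<close>
  have eqI: "(?k \<circ> f) x = y" if "x \<in> carrier M" "y \<in> carrier N" "g y = f x" for x y
    using that bij(2) by (metis comp_apply bij_betw_inv_into_left)
  have "?k \<circ> f \<in> module_hom R M N"
    unfolding module_hom_def
  proof (intro CollectI conjI allI impI)
    show "?k \<circ> f \<in> carrier M \<rightarrow> carrier N" using car by blast
  next
    fix x y assume "x \<in> carrier M \<and> y \<in> carrier M"
    then show "(?k \<circ> f) (x \<oplus>\<^bsub>M\<^esub> y) = (?k \<circ> f) x \<oplus>\<^bsub>N\<^esub> (?k \<circ> f) y"
      using car gk
        by (intro eqI) (simp_all add: module_hom_add[OF hom(1)] module_hom_add[OF hom(2)]
            del: comp_apply)
  next
    fix r x assume "r \<in> carrier R \<and> x \<in> carrier M"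
    then show "(?k \<circ> f) (r \<odot>\<^bsub>M\<^esub> x) = r \<odot>\<^bsub>N\<^esub> (?k \<circ> f) x"
      using car gk
        by (intro eqI) (simp_all add: module_hom_smult[OF hom(1)] module_hom_smult[OF hom(2)]
            del: comp_apply)
  qed
  with comp show ?thesis by (simp add: module_iso_def)
qed

text \<open>The ring is taken to be nonzero: over the zero ring every
  \<open>finsupp_module R S\<close> has exactly one element, whatever the size of \<open>S\<close>.
  Equipollence expresses equal cardinality for sets of different types, finite or infinite.\<close>

theorem theorem11p4:
  fixes R :: "('a, 'c) ring_scheme"
    and M :: "('a, 'm, 'd) module_scheme"
    and S :: "'s set" and T :: "'t set"
  assumes "cring R" and "\<one>\<^bsub>R\<^esub> \<noteq> \<zero>\<^bsub>R\<^esub>"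
    and "module R M"
    and "\<exists>f. f \<in> module_iso R (finsupp_module R S) M"
    and "\<exists>g. g \<in> module_iso R (finsupp_module R T) M"
  shows "S \<approx> T"
proof -
  interpret cring R by fact
  obtain f g where f: "f \<in> module_iso R (finsupp_module R S) M"
    and g: "g \<in> module_iso R (finsupp_module R T) M"
    using assms(4,5) by blast
  note F = finsupp_module_is_module[OF assms(1)]
  show ?thesis
  \<comment> \<open>Composing one isomorphism with the inverse of the other gives surjections
    between the two free modules in both directions, each bounding the index set of its target by
    that of its source.\<close>
  proof (rule lepoll_antisym)
    show "T \<lesssim> S"
      using module_iso_inv_comp[OF F F f g]
      by (intro finsupp_module_surj_lepoll[OF assms(2)])
        (auto simp: module_iso_def bij_betw_def)
    show "S \<lesssim> T"
      using module_iso_inv_comp[OF F F g f]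
      by (intro finsupp_module_surj_lepoll[OF assms(2)])
        (auto simp: module_iso_def bij_betw_def)
  qed
qed

end
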